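(* Let $G$ be a countable amenable group with a F{\o}lner sequence $(F_n)$, let $\Lambda$ be a finite set, let $X\subset\Lambda^G$ be a nonempty subshift with the shift action of $G$, and let $\mathcal U=\mathcal P_\Lambda$ be the time-zero cover of $X$. Then $$h_{\mathsf{top}}(G)=h_{\mathsf{top}}(G,\mathcal U)=\inf_{F\in\mathcal F(G)}\frac1{|F|}H_{\mathsf{top}}(\mathcal U^F).$$
   Context: $\mathcal F(G)$ denotes the collection of all nonempty finite subsets of $G$. A F{\o}lner sequence in $G$ is a sequence $(F_n)$ of nonempty finite subsets of $G$ with $\lim_{n\to\infty}\frac{|F_n\triangle gF_n|}{|F_n|}=0$ for every $g\in G$. The set $\Lambda^G$, whose elements are $x=(x_g)_{g\in G}$, carries the product topology ($\Lambda$ discrete), and $G$ acts on it by shifts, $(gx)_h=x_{hg}$. A subshift is a closed $G$-invariant subset $X\subset\Lambda^G$. The time-zero cover (partition) of $X$ is $\mathcal P_\Lambda=\{[a]:a\in\Lambda\}$, where $[a]=\{x\in X:x_e=a\}$ and $e$ is the unity of $G$. For an open cover $\mathcal U$ of $X$ and $f\in G$ put $f^{-1}\mathcal U=\{f^{-1}U:U\in\mathcal U\}$, and for $F\in\mathcal F(G)$ put $\mathcal U^F=\bigvee_{f\in F}f^{-1}\mathcal U$, where the join $\mathcal U\vee\mathcal V=\{U\cap V:U\in\mathcal U,V\in\mathcal V\}$. $N(\mathcal U)$ is the smallest cardinality of a subcover of $\mathcal U$, and $H_{\mathsf{top}}(\mathcal U)=\log N(\mathcal U)$. Topological entropy of the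 action with respect to $\mathcal U$ is $h_{\mathsf{top}}(G,\mathcal U)=\limsup_{n\to\infty}\frac1{|F_n|}H_{\mathsf{top}}(\mathcal U^{F_n})$, and topological entropy of the action is $h_{\mathsf{top}}(G)=\sup_{\mathcal U}h_{\mathsf{top}}(G,\mathcal U)$, the supremum being over all open covers $\mathcal U$ of $X$. *)

theory Defs
  imports "HOL-Analysis.Analysis" "HOL-Algebra.Coset"
begin

definition finite_nonempty_subsets :: "('g, 'b) monoid_scheme \<Rightarrow> 'g set set" where
  "finite_nonempty_subsets G = {F. F \<subseteq> carrier G \<and> finite F \<and> F \<noteq> {}}"

definition folner_sequence :: "('g, 'b) monoid_scheme \<Rightarrow> (nat \<Rightarrow> 'g set) \<Rightarrow> bool" where
  "folner_sequence G F \<longleftrightarrow>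
     (\<forall>n. F n \<in> finite_nonempty_subsets G) \<and>
     (\<forall>g\<in>carrier G.
        (\<lambda>n. real (card (sym_diff (F n) (g <#\<^bsub>G\<^esub> F n))) / real (card (F n))) \<longlonglongrightarrow> 0)"

text \<open>For countable groups, amenability is the existence of a Folner sequence.\<close>

definition countable_amenable_group :: "('g, 'b) monoid_scheme \<Rightarrow> bool" where
  "countable_amenable_group G \<longleftrightarrow>
     group G \<and> countable (carrier G) \<and> (\<exists>F. folner_sequence G F)"


section \<open>Covers and topological entropy of an action\<close>

definition is_cover :: "'x topology \<Rightarrow> 'x set set \<Rightarrow> bool" where
  "is_cover T \<U> \<longleftrightarrow> (\<forall>U\<in>\<U>. U \<subseteq> topspace T) \<and> \<Union>\<U> = topspace T"

definition open_cover :: "'x topology \<Rightarrow> 'x set set \<Rightarrow> bool" where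
  "open_cover T \<U> \<longleftrightarrow> is_cover T \<U> \<and> (\<forall>U\<in>\<U>. openin T U)"

definition cover_join :: "'x set set \<Rightarrow> 'x set set \<Rightarrow> 'x set set" where
  "cover_join \<U> \<V> = {U \<inter> V |U V. U \<in> \<U> \<and> V \<in> \<V>}"

definition cover_preimage :: "'x topology \<Rightarrow> ('x \<Rightarrow> 'x) \<Rightarrow> 'x set set \<Rightarrow> 'x set set" where
  "cover_preimage T \<phi> \<U> = {{x \<in> topspace T. \<phi> x \<in> U} |U. U \<in> \<U>}"

text \<open>The iterated join of the preimages, written with one choice function \<open>s\<close>
  instead of a recursion over \<open>F\<close>; \<open>cover_power_singleton\<close> and \<open>cover_power_insert\<close> below
  give the recursion through the binary join. Intersecting with the whole space matters only for
  empty \<open>F\<close>.\<close>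

definition cover_power ::
  "'x topology \<Rightarrow> ('g \<Rightarrow> 'x \<Rightarrow> 'x) \<Rightarrow> 'x set set \<Rightarrow> 'g set \<Rightarrow> 'x set set" where
  "cover_power T act \<U> F =
     {topspace T \<inter> (\<Inter>f\<in>F. s f) |s. \<forall>f\<in>F. s f \<in> cover_preimage T (act f) \<U>}"

lemma cover_power_singleton:
  "cover_power T act \<U> {f} = cover_preimage T (act f) \<U>"
proof (intro Set.set_eqI iffI)
  fix A assume "A \<in> cover_power T act \<U> {f}"
  then obtain s where "s f \<in> cover_preimage T (act f) \<U>" "A = topspace T \<inter> s f"
    unfolding cover_power_def by auto
  moreover from this have "s f \<subseteq> topspace T"
    unfolding cover_preimage_def by auto
  ultimately show "A \<in> cover_preimage T (act f) \<U>"
    by (simp add: Int_absorb1)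
next
  fix A assume A: "A \<in> cover_preimage T (act f) \<U>"
  then have "A = topspace T \<inter> (\<Inter>h\<in>{f}. (\<lambda>_. A) h)"
    unfolding cover_preimage_def by auto
  with A show "A \<in> cover_power T act \<U> {f}"
    unfolding cover_power_def mem_Collect_eq by (intro exI[of _ "\<lambda>_. A"]) simp
qed

lemma cover_power_insert:
  assumes "f \<notin> F"
  shows "cover_power T act \<U> (insert f F) =
           cover_join (cover_preimage T (act f) \<U>) (cover_power T act \<U> F)" (is "?L = ?R")
proof
  show "?L \<subseteq> ?R"
  proof
    fix A assume "A \<in> ?L"
    then obtain s where s: "\<forall>h\<in>insert f F. s h \<in> cover_preimage T (act h) \<U>"
      and A: "A = topspace T \<inter> (\<Inter>h\<in>insert f F. s h)"
      unfolding cover_power_def by blast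
    have "A = s f \<inter> (topspace T \<inter> (\<Inter>h\<in>F. s h))"
      using A by auto
    moreover have "topspace T \<inter> (\<Inter>h\<in>F. s h) \<in> cover_power T act \<U> F"
      unfolding cover_power_def using s by blast
    ultimately show "A \<in> ?R"
      unfolding cover_join_def using s by blast
  qed
next
  show "?R \<subseteq> ?L"
  proof
    fix A assume "A \<in> ?R"
    then obtain U s where U: "U \<in> cover_preimage T (act f) \<U>"
      and s: "\<forall>h\<in>F. s h \<in> cover_preimage T (act h) \<U>"
      and A: "A = U \<inter> (topspace T \<inter> (\<Inter>h\<in>F. s h))"
      unfolding cover_join_def cover_power_def by blast
    have "A = topspace T \<inter> (\<Inter>h\<in>insert f F. (s(f := U)) h)"
      using A assms by auto
    moreover have "\<forall>h\<in>insert f F. (s(f := U)) h \<in> cover_preimage T (act h) \<U>"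
      using U s assms by auto
    ultimately show "A \<in> ?L"
      unfolding cover_power_def by blast
  qed
qed

text \<open>Only finite subcovers are considered, since \<open>card\<close> is \<open>0\<close> on infinite sets;
  on a compact space every open cover has one.\<close>

definition cover_number :: "'x topology \<Rightarrow> 'x set set \<Rightarrow> nat" where
  "cover_number T \<U> = (LEAST n. \<exists>\<V>\<subseteq>\<U>. finite \<V> \<and> is_cover T \<V> \<and> card \<V> = n)"

definition H_top :: "'x topology \<Rightarrow> 'x set set \<Rightarrow> real" where
  "H_top T \<U> = ln (real (cover_number T \<U>))"

text \<open>Entropies take values in \<open>ereal\<close>, so that limsup and supremum always exist.\<close>

definition h_top_cover ::
  "'x topology \<Rightarrow> ('g \<Rightarrow> 'x \<Rightarrow> 'x) \<Rightarrow> (nat \<Rightarrow> 'g set) \<Rightarrow> 'x set set \<Rightarrow> ereal" where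
  "h_top_cover T act F \<U> =
     limsup (\<lambda>n. ereal (H_top T (cover_power T act \<U> (F n)) / real (card (F n))))"

definition h_top ::
  "'x topology \<Rightarrow> ('g \<Rightarrow> 'x \<Rightarrow> 'x) \<Rightarrow> (nat \<Rightarrow> 'g set) \<Rightarrow> ereal" where
  "h_top T act F = (SUP \<U> \<in> {\<U>. open_cover T \<U>}. h_top_cover T act F \<U>)"


section \<open>Subshifts\<close>

text \<open>Configurations are the extensional functions on \<open>carrier G\<close> with values in
  \<open>\<Lambda>\<close>; these form the underlying set of the product topology.\<close>

definition full_shift :: "('g, 'b) monoid_scheme \<Rightarrow> 'a set \<Rightarrow> ('g \<Rightarrow> 'a) topology" where
  "full_shift G \<Lambda> = product_topology (\<lambda>_. discrete_topology \<Lambda>) (carrier G)"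

definition shift :: "('g, 'b) monoid_scheme \<Rightarrow> 'g \<Rightarrow> ('g \<Rightarrow> 'a) \<Rightarrow> ('g \<Rightarrow> 'a)" where
  "shift G g x = (\<lambda>h\<in>carrier G. x (h \<otimes>\<^bsub>G\<^esub> g))"

definition subshift :: "('g, 'b) monoid_scheme \<Rightarrow> 'a set \<Rightarrow> ('g \<Rightarrow> 'a) set \<Rightarrow> bool" where
  "subshift G \<Lambda> X \<longleftrightarrow>
     closedin (full_shift G \<Lambda>) X \<and> (\<forall>g\<in>carrier G. \<forall>x\<in>X. shift G g x \<in> X)"

definition subshift_topology ::
  "('g, 'b) monoid_scheme \<Rightarrow> 'a set \<Rightarrow> ('g \<Rightarrow> 'a) set \<Rightarrow> ('g \<Rightarrow> 'a) topology" where
  "subshift_topology G \<Lambda> X = subtopology (full_shift G \<Lambda>) X"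

definition time_zero_cover ::
  "('g, 'b) monoid_scheme \<Rightarrow> 'a set \<Rightarrow> ('g \<Rightarrow> 'a) set \<Rightarrow> ('g \<Rightarrow> 'a) set set" where
  "time_zero_cover G \<Lambda> X = {{x \<in> X. x \<one>\<^bsub>G\<^esub> = a} |a. a \<in> \<Lambda>}"

end

theory Submission
  imports Defs
begin

text \<open>Let \<open>W K\<close> be the number of patterns that configurations of \<open>X\<close> show on \<open>K\<close>, so that
  \<open>H_top (P\<^sup>K) = ln (W K)\<close> for the time-zero cover \<open>P\<close>. Every point of a Folner set \<open>F\<^sub>n\<close> lies in
  exactly \<open>|K|\<close> of the right translates \<open>Kg\<close> with \<open>g \<in> K\<inverse>F\<^sub>n\<close>, and \<open>W (Kg) = W K\<close> by shift invariance;
  Shearer's inequality gives \<open>|K| ln W(F\<^sub>n) \<le> |K\<inverse>F\<^sub>n| ln W(K)\<close>, and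
  \<open>|K\<inverse>F\<^sub>n| / |F\<^sub>n|\<close> tends to \<open>1\<close>. By compactness every open cover \<open>U\<close> is refined by some
  \<open>P\<^sup>K\<close>, and passing from \<open>W(F\<^sub>n)\<close> to \<open>W(KF\<^sub>n)\<close> costs a factor at most
  \<open>|\<Lambda>|\<close> per point of \<open>KF\<^sub>n - F\<^sub>n\<close>, which is negligible, so \<open>U\<close> has no more entropy than
  the infimum either.\<close>

section \<open>Hoelder's inequality for several factors\<close>

text \<open>After each \<open>b i\<close> is divided by its sum over \<open>A\<close>, the
  inequality of arithmetic and geometric means bounds every product by an average over
  \<open>J\<close>, and these averages add up to 1 over \<open>A\<close>.\<close>

lemma Holder_prod:
  fixes b :: "'i \<Rightarrow> 'a \<Rightarrow> real"
  assumes "finite J" "J \<noteq> {}" "finite A"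
    and nonneg: "\<And>i a. i \<in> J \<Longrightarrow> a \<in> A \<Longrightarrow> 0 \<le> b i a"
  shows "(\<Sum>a\<in>A. \<Prod>i\<in>J. b i a powr (1 / card J))
           \<le> (\<Prod>i\<in>J. (\<Sum>a\<in>A. b i a) powr (1 / card J))"
\<comment> \<open>A vanishing sum cannot be normalised. In that case one factor is 0 for every
  \<open>a\<close>, and since \<open>0 powr _ = 0\<close> the left side is 0.\<close>
proof (cases "\<exists>i\<in>J. (\<Sum>a\<in>A. b i a) = 0")
  case True
  then obtain i where i: "i \<in> J" "\<forall>a\<in>A. b i a = 0"
    using nonneg \<open>finite A\<close> by (metis sum_nonneg_eq_0_iff)
  then have "(\<Prod>i\<in>J. b i a powr (1 / card J)) = 0" if "a \<in> A" for a
    using that \<open>finite J\<close> by (metis (mono_tags, lifting) powr_0 prod_zero)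
  then show ?thesis
    by (simp add: prod_nonneg)
next
  case False
  define B where "B i = (\<Sum>a\<in>A. b i a)" for i
  let ?k = "1 / real (card J)"
  have pos: "0 < B i" if "i \<in> J" for i
    using False that nonneg sum_nonneg[of A "b i"] unfolding B_def by fastforce
  have card: "0 < card J"
    using assms by (simp add: card_gt_0_iff)
  have "(\<Sum>a\<in>A. \<Prod>i\<in>J. (b i a / B i) powr ?k) \<le> (\<Sum>a\<in>A. \<Sum>i\<in>J. b i a / B i / card J)"
  proof (rule sum_mono)
    fix a assume "a \<in> A"
    then have "0 \<le> b i a / B i" if "i \<in> J" for i
      using pos nonneg that by (simp add: less_imp_le)
    then show "(\<Prod>i\<in>J. (b i a / B i) powr ?k) \<le> (\<Sum>i\<in>J. b i a / B i / card J)"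
      using arith_geom_mean[OF \<open>finite J\<close> \<open>J \<noteq> {}\<close>, of "\<lambda>i. b i a / B i"]
      by (simp add: prod_powr_distrib)
  qed
  also have "\<dots> = (\<Sum>i\<in>J. \<Sum>a\<in>A. b i a / B i / card J)"
    by (rule sum.swap)
  also have "\<dots> = (\<Sum>i\<in>J. 1 / card J)"
  proof (rule sum.cong)
    fix i assume "i \<in> J"
    then show "(\<Sum>a\<in>A. b i a / B i / card J) = 1 / card J"
      using pos[of i] by (simp flip: sum_divide_distrib B_def)
  qed simp
  also have "\<dots> = 1"
    using card by simp
  finally have normalised: "(\<Sum>a\<in>A. \<Prod>i\<in>J. (b i a / B i) powr ?k) \<le> 1" .
  have "(\<Prod>i\<in>J. b i a powr ?k) = (\<Prod>i\<in>J. B i powr ?k) * (\<Prod>i\<in>J. (b i a / B i) powr ?k)"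
    if "a \<in> A" for a
    unfolding prod.distrib[symmetric]
    by (rule prod.cong) (auto simp: powr_divide dest!: pos)
  then have "(\<Sum>a\<in>A. \<Prod>i\<in>J. b i a powr ?k)
      = (\<Prod>i\<in>J. B i powr ?k) * (\<Sum>a\<in>A. \<Prod>i\<in>J. (b i a / B i) powr ?k)"
    by (simp add: sum_distrib_left)
  also have "\<dots> \<le> (\<Prod>i\<in>J. B i powr ?k)"
    using normalised by (simp add: mult_left_le prod_nonneg)
  finally show ?thesis
    unfolding B_def .
qed

section \<open>Pattern counts and Shearer's inequality\<close>

text \<open>\<open>restrict\<close> puts \<open>undefined\<close> outside \<open>K\<close>, so
  configurations that agree on \<open>K\<close> become the same function. \<open>X\<close> may be
  any set of functions because the induction for Shearer's inequality passes to slices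
  \<open>{x\<in>X. x h = a}\<close>, which need not be shift invariant.\<close>

definition pattern_count :: "('g \<Rightarrow> 'a) set \<Rightarrow> 'g set \<Rightarrow> nat" where
  "pattern_count X K = card ((\<lambda>x. restrict x K) ` X)"

lemma finite_patterns:
  assumes "finite K" "finite \<Lambda>" "\<And>x h. x \<in> X \<Longrightarrow> h \<in> K \<Longrightarrow> x h \<in> \<Lambda>"
  shows "finite ((\<lambda>x. restrict x K) ` X)"
proof (rule finite_subset)
  show "(\<lambda>x. restrict x K) ` X \<subseteq> (\<Pi>\<^sub>E h\<in>K. \<Lambda>)"
    using assms(3) by auto
  show "finite (\<Pi>\<^sub>E h\<in>K. \<Lambda>)"
    using assms by (simp add: finite_PiE)
qed

lemma pattern_count_pos:
  assumes "finite K" "finite \<Lambda>" "\<And>x h. x \<in> X \<Longrightarrow> h \<in> K \<Longrightarrow> x h \<in> \<Lambda>" "X \<noteq> {}"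
  shows "0 < pattern_count X K"
  unfolding pattern_count_def using finite_patterns[of K \<Lambda> X] assms by (simp add: card_gt_0_iff)

lemma pattern_count_mono_set:
  assumes "finite K" "finite \<Lambda>" "\<And>x h. x \<in> Y \<Longrightarrow> h \<in> K \<Longrightarrow> x h \<in> \<Lambda>" "X \<subseteq> Y"
  shows "pattern_count X K \<le> pattern_count Y K"
  unfolding pattern_count_def
  by (rule card_mono) (use assms in \<open>auto intro!: finite_patterns[of K \<Lambda>]\<close>)

lemma pattern_count_mono:
  assumes "finite L" "finite \<Lambda>" "\<And>x h. x \<in> X \<Longrightarrow> h \<in> L \<Longrightarrow> x h \<in> \<Lambda>" "K \<subseteq> L"
  shows "pattern_count X K \<le> pattern_count X L"
proof -
  have "(\<lambda>x. restrict x K) ` X = (\<lambda>p. restrict p K) ` (\<lambda>x. restrict x L) ` X"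
    using \<open>K \<subseteq> L\<close> by (simp add: image_image Int_absorb1)
  then show ?thesis
    unfolding pattern_count_def using finite_patterns[of L \<Lambda> X] assms by (simp add: card_image_le)
qed

text \<open>Inside a slice the value at \<open>h\<close> is fixed, so forgetting it loses no
  information, and slices for different letters show disjoint sets of patterns.\<close>

lemma pattern_count_insert:
  assumes "h \<notin> K" "finite K" "finite \<Lambda>"
    and "\<And>x j. x \<in> X \<Longrightarrow> j \<in> insert h K \<Longrightarrow> x j \<in> \<Lambda>"
  shows "pattern_count X (insert h K) = (\<Sum>a\<in>\<Lambda>. pattern_count {x\<in>X. x h = a} K)"
proof -
  define P where "P a = (\<lambda>x. restrict x (insert h K)) ` {x\<in>X. x h = a}" for a
  have value_h: "p h = a" if "p \<in> P a" for p a
    using that by (auto simp: P_def)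
  have "(\<lambda>x. restrict x (insert h K)) ` X = (\<Union>a\<in>\<Lambda>. P a)"
    using assms(4) by (auto simp: P_def)
  moreover have "card (\<Union>a\<in>\<Lambda>. P a) = (\<Sum>a\<in>\<Lambda>. card (P a))"
  proof (rule card_UN_disjoint)
    show "\<forall>a\<in>\<Lambda>. finite (P a)"
      using assms unfolding P_def by (auto intro!: finite_patterns[of _ \<Lambda>])
    show "\<forall>a\<in>\<Lambda>. \<forall>b\<in>\<Lambda>. a \<noteq> b \<longrightarrow> P a \<inter> P b = {}"
      using value_h by blast
  qed fact
  moreover have "card (P a) = pattern_count {x\<in>X. x h = a} K" for a
  proof -
    have "inj_on (\<lambda>p. restrict p K) (P a)"
    proof (rule inj_onI)
      fix p q assume pq: "p \<in> P a" "q \<in> P a" and eq: "restrict p K = restrict q K"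
      have ext: "p \<in> extensional (insert h K)" "q \<in> extensional (insert h K)"
        using pq by (auto simp: P_def)
      show "p = q"
      proof (rule extensionalityI[OF ext])
        fix j assume "j \<in> insert h K"
        then show "p j = q j"
          using value_h[OF pq(1)] value_h[OF pq(2)] fun_cong[OF eq, of j] by auto
      qed
    qed
    then have "card (P a) = card ((\<lambda>p. restrict p K) ` P a)"
      by (simp add: card_image)
    also have "(\<lambda>p. restrict p K) ` P a = (\<lambda>x. restrict x K) ` {x\<in>X. x h = a}"
      unfolding P_def image_image
      by (rule image_cong) (simp_all add: Int_absorb1 subset_insertI)
    finally show ?thesis
      by (simp add: pattern_count_def)
  qed
  ultimately show ?thesis
    by (simp add: pattern_count_def)
qed

text \<open>Each coordinate of \<open>D\<close> takes at most \<open>card \<Lambda>\<close> values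
  and so multiplies the count by at most that factor. \<open>D\<close> may meet
  \<open>K\<close>.\<close>

lemma pattern_count_Un_le:
  assumes "finite D" "finite K" "finite \<Lambda>" "\<And>x j. x \<in> X \<Longrightarrow> j \<in> K \<union> D \<Longrightarrow> x j \<in> \<Lambda>"
  shows "pattern_count X (K \<union> D) \<le> pattern_count X K * card \<Lambda> ^ card D"
  using assms(1,4)
proof (induction D rule: finite_induct)
  case (insert h D)
  have IH: "pattern_count X (K \<union> D) \<le> pattern_count X K * card \<Lambda> ^ card D"
    using insert by auto
  have step: "pattern_count X (K \<union> insert h D) \<le> card \<Lambda> * pattern_count X (K \<union> D)"
  proof (cases "h \<in> K")
    case True
    show ?thesis
    \<comment> \<open>A repeated coordinate adds no pattern, but the bound still gains a factor
      \<open>card \<Lambda>\<close>. This factor is at least 1 unless the alphabet, and with it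
      \<open>X\<close>, is empty.\<close>
    proof (cases "\<Lambda> = {}")
      case True
      then have "X = {}"
        using insert.prems by auto
      then show ?thesis
        by (simp add: pattern_count_def)
    next
      case False
      then have "1 \<le> card \<Lambda>"
        using \<open>finite \<Lambda>\<close> by (simp add: Suc_le_eq card_gt_0_iff)
      moreover have "K \<union> insert h D = K \<union> D"
        using \<open>h \<in> K\<close> by auto
      ultimately show ?thesis
        by (metis mult.commute mult.right_neutral mult_le_mono2)
    qed
  next
    case False
    have "pattern_count X (K \<union> insert h D) = pattern_count X (insert h (K \<union> D))"
      by simp
    also have "\<dots> = (\<Sum>a\<in>\<Lambda>. pattern_count {x\<in>X. x h = a} (K \<union> D))"
      by (rule pattern_count_insert) (use assms insert False in auto)
    also have "\<dots> \<le> (\<Sum>a\<in>\<Lambda>. pattern_count X (K \<union> D))"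
      by (intro sum_mono pattern_count_mono_set[of _ \<Lambda>]) (use assms insert in auto)
    finally show ?thesis
      by simp
  qed
  show ?case
    using order_trans[OF step mult_le_mono2[OF IH]] insert by (simp add: ac_simps)
qed simp

text \<open>Shearer's inequality for projections. Splitting at the new coordinate \<open>h\<close> leaves the
  projections that do not see \<open>h\<close> bounded by the full ones, while exactly \<open>k\<close> of them do see \<open>h\<close>,
  so that Hoelder's inequality with \<open>k\<close> factors applies to the sum over the value at \<open>h\<close>.\<close>

lemma pattern_count_Shearer:
  assumes "finite K" "finite I" "0 < k" "finite \<Lambda>"
    and "\<And>h. h \<in> K \<Longrightarrow> card {i\<in>I. h \<in> S i} = k"
    and "\<And>x h. x \<in> X \<Longrightarrow> h \<in> K \<Longrightarrow> x h \<in> \<Lambda>"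
  shows "real (pattern_count X K) \<le> (\<Prod>i\<in>I. real (pattern_count X (S i \<inter> K)) powr (1 / k))"
  using assms(1,5,6)
proof (induction K arbitrary: X rule: finite_induct)
  case empty
  \<comment> \<open>On the empty set a nonempty \<open>X\<close> has exactly one pattern, so all
    factors on the right are 1; an empty \<open>X\<close> makes the left side 0.\<close>
  have "(\<lambda>x. restrict x {}) ` X = (if X = {} then {} else {\<lambda>_. undefined})"
    by (auto simp: restrict_def)
  then show ?case
    by (simp add: pattern_count_def prod_nonneg)
next
  case (insert h K)
  define J where "J = {i\<in>I. h \<in> S i}"
  define Y where "Y a = {x\<in>X. x h = a}" for a
  let ?w = "\<lambda>X i L. real (pattern_count X (S i \<inter> L)) powr (1 / k)"
  have J: "finite J" "J \<noteq> {}" "card J = k" "J \<subseteq> I"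
    using insert.prems(1)[of h] assms(2,3) by (auto simp: J_def card_gt_0_iff)
  have in_J: "pattern_count X (S i \<inter> insert h K) = (\<Sum>a\<in>\<Lambda>. pattern_count (Y a) (S i \<inter> K))"
    if "i \<in> J" for i
  proof -
    have "S i \<inter> insert h K = insert h (S i \<inter> K)"
      using that by (auto simp: J_def)
    moreover have "pattern_count X (insert h (S i \<inter> K))
        = (\<Sum>a\<in>\<Lambda>. pattern_count (Y a) (S i \<inter> K))"
      unfolding Y_def by (rule pattern_count_insert) (use insert assms(4) in auto)
    ultimately show ?thesis
      by simp
  qed
  have off_J: "?w (Y a) i K \<le> ?w X i (insert h K)" if "i \<in> I - J" for i a
  proof -
    have "S i \<inter> insert h K = S i \<inter> K"
      using that by (auto simp: J_def)
    moreover have "pattern_count (Y a) (S i \<inter> K) \<le> pattern_count X (S i \<inter> K)"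
      unfolding Y_def by (rule pattern_count_mono_set[of _ \<Lambda>]) (use insert assms(4) in auto)
    ultimately show ?thesis
      by (simp add: powr_mono2)
  qed
  have split: "(\<Prod>i\<in>I. f i) = (\<Prod>i\<in>I - J. f i) * (\<Prod>i\<in>J. f i)" for f :: "_ \<Rightarrow> real"
    using J assms(2) by (simp add: prod.subset_diff)
  have "real (pattern_count X (insert h K)) = (\<Sum>a\<in>\<Lambda>. real (pattern_count (Y a) K))"
    unfolding Y_def
    by (subst pattern_count_insert[of h K \<Lambda>]) (use insert assms(4) in auto)
  \<comment> \<open>The induction hypothesis is applied to each slice \<open>Y a\<close> in place of
    \<open>X\<close>.\<close>
  also have "\<dots> \<le> (\<Sum>a\<in>\<Lambda>. \<Prod>i\<in>I. ?w (Y a) i K)"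
    by (intro sum_mono insert.IH) (use insert.prems in \<open>auto simp: Y_def\<close>)
  also have "\<dots> = (\<Sum>a\<in>\<Lambda>. (\<Prod>i\<in>I - J. ?w (Y a) i K) * (\<Prod>i\<in>J. ?w (Y a) i K))"
    by (simp add: split)
  also have "\<dots> \<le> (\<Sum>a\<in>\<Lambda>. (\<Prod>i\<in>I - J. ?w X i (insert h K)) * (\<Prod>i\<in>J. ?w (Y a) i K))"
    by (intro sum_mono mult_right_mono prod_mono) (use off_J in \<open>auto intro: prod_nonneg\<close>)
  also have "\<dots> = (\<Prod>i\<in>I - J. ?w X i (insert h K)) * (\<Sum>a\<in>\<Lambda>. \<Prod>i\<in>J. ?w (Y a) i K)"
    by (simp add: sum_distrib_left)
  also have "\<dots> \<le> (\<Prod>i\<in>I - J. ?w X i (insert h K)) * (\<Prod>i\<in>J. ?w X i (insert h K))"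
  proof (rule mult_left_mono)
    show "(\<Sum>a\<in>\<Lambda>. \<Prod>i\<in>J. ?w (Y a) i K) \<le> (\<Prod>i\<in>J. ?w X i (insert h K))"
      using Holder_prod[OF J(1,2) assms(4), of "\<lambda>i a. real (pattern_count (Y a) (S i \<inter> K))"]
      by (simp add: in_J J(3))
  qed (simp add: prod_nonneg)
  also have "\<dots> = (\<Prod>i\<in>I. ?w X i (insert h K))"
    by (simp add: split)
  finally show ?case .
qed

section \<open>Boundaries of Folner sets\<close>

text \<open>A point of \<open>K <#> F n\<close> outside \<open>F n\<close> lies in some
  \<open>k <# F n\<close> but not in \<open>F n\<close>, hence in one of finitely many symmetric
  differences, each of vanishing relative size.\<close>

lemma (in group) folner_boundary:
  assumes "folner_sequence G F" "finite K" "K \<subseteq> carrier G"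
  shows "(\<lambda>n. real (card ((K <#> F n) - F n)) / real (card (F n))) \<longlonglongrightarrow> 0"
proof (rule tendsto_sandwich[OF _ _ tendsto_const])
  let ?D = "\<lambda>n k. sym_diff (F n) (k <# F n)"
  have fin: "finite (F n)" for n
    using assms(1) unfolding folner_sequence_def finite_nonempty_subsets_def by blast
  have "card ((K <#> F n) - F n) \<le> (\<Sum>k\<in>K. card (?D n k))" for n
  proof -
    have "(K <#> F n) - F n \<subseteq> (\<Union>k\<in>K. ?D n k)"
      unfolding set_mult_def l_coset_def by blast
    moreover have "finite (\<Union>k\<in>K. ?D n k)"
      using \<open>finite K\<close> fin unfolding l_coset_def by blast
    ultimately have "card ((K <#> F n) - F n) \<le> card (\<Union>k\<in>K. ?D n k)"
      by (rule card_mono[rotated])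
    also have "\<dots> \<le> (\<Sum>k\<in>K. card (?D n k))"
      by (rule card_UN_le[OF \<open>finite K\<close>])
    finally show ?thesis .
  qed
  then have "real (card ((K <#> F n) - F n)) / real (card (F n))
      \<le> (\<Sum>k\<in>K. real (card (?D n k)) / real (card (F n)))" for n
    unfolding sum_divide_distrib[symmetric] of_nat_sum[symmetric]
    by (intro divide_right_mono of_nat_mono) auto
  then show "\<forall>\<^sub>F n in sequentially. real (card ((K <#> F n) - F n)) / real (card (F n))
      \<le> (\<Sum>k\<in>K. real (card (?D n k)) / real (card (F n)))"
    by simp
  have "(\<lambda>n. \<Sum>k\<in>K. real (card (?D n k)) / real (card (F n))) \<longlonglongrightarrow> (\<Sum>k\<in>K. 0)"
    by (rule tendsto_sum) (use assms in \<open>auto simp: folner_sequence_def\<close>)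
  then show "(\<lambda>n. \<Sum>k\<in>K. real (card (?D n k)) / real (card (F n))) \<longlonglongrightarrow> 0"
    by simp
qed simp

section \<open>Subshifts over a finite alphabet\<close>

locale finite_alphabet_subshift = group G for G :: "('g, 'b) monoid_scheme" (structure) +
  fixes \<Lambda> :: "'a set" and X :: "('g \<Rightarrow> 'a) set"
  assumes finite_alphabet: "finite \<Lambda>"
    and subshift: "subshift G \<Lambda> X"
    and nonempty: "X \<noteq> {}"
begin

abbreviation T :: "('g \<Rightarrow> 'a) topology" where
  "T \<equiv> subshift_topology G \<Lambda> X"

abbreviation P :: "('g \<Rightarrow> 'a) set set" where
  "P \<equiv> time_zero_cover G \<Lambda> X"

lemma X_subset: "X \<subseteq> (\<Pi>\<^sub>E h\<in>carrier G. \<Lambda>)"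
  using subshift closedin_subset[of "full_shift G \<Lambda>" X]
  unfolding subshift_def full_shift_def by simp

lemma value_in_alphabet: "x \<in> X \<Longrightarrow> h \<in> carrier G \<Longrightarrow> x h \<in> \<Lambda>"
  using X_subset by blast

lemma shift_in: "g \<in> carrier G \<Longrightarrow> x \<in> X \<Longrightarrow> shift G g x \<in> X"
  using subshift unfolding subshift_def by blast

lemma topspace_T [simp]: "topspace T = X"
  using X_subset unfolding subshift_topology_def full_shift_def by auto

lemma patterns_pos: "finite K \<Longrightarrow> K \<subseteq> carrier G \<Longrightarrow> 0 < pattern_count X K"
  by (rule pattern_count_pos[OF _ finite_alphabet]) (auto simp: nonempty intro: value_in_alphabet)

lemma ln_card_alphabet_nonneg: "0 \<le> ln (real (card \<Lambda>))"
proof -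
  obtain x where "x \<in> X"
    using nonempty by blast
  then have "\<Lambda> \<noteq> {}"
    using value_in_alphabet by blast
  then have "1 \<le> card \<Lambda>"
    using finite_alphabet by (simp add: Suc_le_eq card_gt_0_iff)
  then show ?thesis
    by simp
qed

text \<open>The entry of \<open>x\<close> at \<open>k \<otimes> g\<close> is the entry of
  \<open>shift G g x\<close> at \<open>k\<close>, so a pattern on \<open>K #> g\<close> is a
  relabelled pattern on \<open>K\<close> of another point of \<open>X\<close>.\<close>

lemma pattern_count_r_coset_le:
  assumes K: "finite K" "K \<subseteq> carrier G" and g: "g \<in> carrier G"
  shows "pattern_count X (K #> g) \<le> pattern_count X K"
proof -
  define \<phi> where "\<phi> p = (\<lambda>h\<in>K #> g. p (h \<otimes> inv g))" for p :: "'g \<Rightarrow> 'a"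
  have "restrict x (K #> g) = \<phi> (restrict (shift G g x) K)" for x
  proof
    fix h
    show "restrict x (K #> g) h = \<phi> (restrict (shift G g x) K) h"
    proof (cases "h \<in> K #> g")
      case True
      then obtain k where k: "k \<in> K" "h = k \<otimes> g"
        by (auto simp: r_coset_def)
      moreover from this have "k \<in> carrier G"
        using K by blast
      ultimately show ?thesis
        using True g by (simp add: \<phi>_def shift_def m_assoc)
    qed (simp add: \<phi>_def)
  qed
  then have "(\<lambda>x. restrict x (K #> g)) ` X \<subseteq> \<phi> ` (\<lambda>x. restrict x K) ` X"
    using shift_in[OF g] by auto
  moreover have "finite ((\<lambda>x. restrict x K) ` X)"
    by (rule finite_patterns[OF _ finite_alphabet]) (use K value_in_alphabet in auto)
  ultimately show ?thesis
    unfolding pattern_count_def by (rule surj_card_le[rotated])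
qed

text \<open>The translates \<open>K #> g\<close> with \<open>g \<in> K\<inverse> <#> L\<close> cover every point of \<open>L\<close> exactly
  \<open>card K\<close> times.\<close>

lemma ln_pattern_count_le:
  assumes K: "finite K" "K \<subseteq> carrier G" "K \<noteq> {}" and L: "finite L" "L \<subseteq> carrier G"
  shows "ln (pattern_count X L)
           \<le> real (card ((m_inv G ` K) <#> L)) * (ln (pattern_count X K) / card K)"
proof -
  define I where "I = (m_inv G ` K) <#> L"
  let ?k = "real (card K)"
  have card: "0 < card K"
    using K by (simp add: card_gt_0_iff)
  have I: "finite I" "I \<subseteq> carrier G"
    using K L unfolding I_def set_mult_def by auto
  have mult: "card {g\<in>I. h \<in> K #> g} = card K" if "h \<in> L" for h
  proof -
    \<comment> \<open>Solving \<open>h = k \<otimes> g\<close> for \<open>g\<close> gives one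
      translate for each \<open>k \<in> K\<close>, different for different \<open>k\<close>; the
      index set \<open>I\<close> is chosen to contain all of them.\<close>
    have h: "h \<in> carrier G"
      using that L by blast
    have "{g\<in>I. h \<in> K #> g} = (\<lambda>k. inv k \<otimes> h) ` K"
    proof (intro subset_antisym subsetI)
      fix g assume "g \<in> {g\<in>I. h \<in> K #> g}"
      then obtain k where k: "k \<in> K" "h = k \<otimes> g" and g: "g \<in> carrier G"
        using I by (auto simp: r_coset_def)
      moreover have "k \<in> carrier G"
        using k K by blast
      ultimately show "g \<in> (\<lambda>k. inv k \<otimes> h) ` K"
        by (intro image_eqI[of _ _ k]) (simp_all flip: m_assoc)
    next
      fix g assume "g \<in> (\<lambda>k. inv k \<otimes> h) ` K"
      then obtain k where k: "k \<in> K" "g = inv k \<otimes> h"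
        by blast
      then have "k \<in> carrier G"
        using K by blast
      then have "h = k \<otimes> g"
        using k h by (simp flip: m_assoc)
      moreover have "g \<in> I"
        using k that unfolding I_def set_mult_def by blast
      ultimately show "g \<in> {g\<in>I. h \<in> K #> g}"
        using k unfolding r_coset_def by blast
    qed
    moreover have "inj_on (\<lambda>k. inv k \<otimes> h) K"
      by (rule inj_onI) (use K h in \<open>auto dest!: subsetD[OF K(2)] inv_inj[THEN inj_onD]\<close>)
    ultimately show ?thesis
      by (simp add: card_image)
  qed
  have "real (pattern_count X L) \<le> (\<Prod>g\<in>I. real (pattern_count X ((K #> g) \<inter> L)) powr (1 / ?k))"
    by (rule pattern_count_Shearer[OF L(1) I(1) card finite_alphabet mult])
       (use L value_in_alphabet in auto)
  \<comment> \<open>Translates may stick out of \<open>L\<close>: enlarging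
    \<open>(K #> g) \<inter> L\<close> to \<open>K #> g\<close> only increases the count, which
    translation back to \<open>K\<close> then bounds uniformly in \<open>g\<close>.\<close>
  also have "\<dots> \<le> (\<Prod>g\<in>I. real (pattern_count X K) powr (1 / ?k))"
  proof (rule prod_mono, intro conjI powr_mono2 of_nat_mono)
    fix g assume "g \<in> I"
    then have g: "g \<in> carrier G"
      using I by blast
    then have sub: "K #> g \<subseteq> carrier G"
      using K(2) by (rule r_coset_subset_G[rotated])
    have "pattern_count X ((K #> g) \<inter> L) \<le> pattern_count X (K #> g)"
      by (rule pattern_count_mono[OF _ finite_alphabet])
         (use K sub value_in_alphabet in \<open>auto simp: r_coset_def\<close>)
    also have "\<dots> \<le> pattern_count X K"
      by (rule pattern_count_r_coset_le[OF K(1,2) g])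
    finally show "pattern_count X ((K #> g) \<inter> L) \<le> pattern_count X K" .
  qed auto
  also have "\<dots> = real (pattern_count X K) powr (card I / ?k)"
    using patterns_pos[OF K(1,2)] by (simp add: powr_power)
  finally have "ln (pattern_count X L) \<le> ln (real (pattern_count X K) powr (card I / ?k))"
    using patterns_pos[OF L] by (intro ln_mono) simp_all
  then show ?thesis
    using patterns_pos[OF K(1,2)] by (simp add: ln_powr I_def)
qed

section \<open>Subcovers and pattern counts\<close>

text \<open>By \<open>refine\<close>, the coordinates in \<open>K\<close> decide a member of
  \<open>\<U>\<close>. The entry of \<open>shift G f x\<close> at \<open>k\<close> is that of
  \<open>x\<close> at \<open>k \<otimes> f\<close>, so all points sharing the pattern of
  \<open>x\<close> on \<open>K <#> F\<close> lie in one member of the iterated join.\<close>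

lemma small_subcover:
  assumes K: "finite K" "K \<subseteq> carrier G" and F: "finite F" "F \<subseteq> carrier G"
    and refine: "\<And>x. x \<in> X \<Longrightarrow> \<exists>U\<in>\<U>. \<forall>y\<in>X. (\<forall>k\<in>K. y k = x k) \<longrightarrow> y \<in> U"
  obtains \<V> where "\<V> \<subseteq> cover_power T (shift G) \<U> F" "finite \<V>" "is_cover T \<V>"
    "card \<V> \<le> pattern_count X (K <#> F)"
proof -
  define Q where "Q = (\<lambda>x. restrict x (K <#> F)) ` X"
  have "\<forall>x\<in>X. \<exists>U. U \<in> \<U> \<and> (\<forall>y\<in>X. (\<forall>k\<in>K. y k = x k) \<longrightarrow> y \<in> U)"
    using refine by blast
  then obtain u where u: "\<And>x. x \<in> X \<Longrightarrow> u x \<in> \<U>"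
    "\<And>x y. x \<in> X \<Longrightarrow> y \<in> X \<Longrightarrow> \<forall>k\<in>K. y k = x k \<Longrightarrow> y \<in> u x"
    by metis
  define A where "A x = X \<inter> (\<Inter>f\<in>F. {y\<in>X. shift G f y \<in> u (shift G f x)})" for x
  have A_mem: "A x \<in> cover_power T (shift G) \<U> F" if "x \<in> X" for x
    unfolding cover_power_def cover_preimage_def A_def topspace_T mem_Collect_eq
    by (intro exI[of _ "\<lambda>f. {y\<in>X. shift G f y \<in> u (shift G f x)}"])
       (use that F shift_in u(1) in blast)
  have in_A: "y \<in> A x" if "x \<in> X" "y \<in> X" "restrict y (K <#> F) = restrict x (K <#> F)" for x y
  proof -
    have "shift G f y \<in> u (shift G f x)" if "f \<in> F" for f
    proof (rule u(2))
      show "\<forall>k\<in>K. shift G f y k = shift G f x k"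
      proof
        fix k assume "k \<in> K"
        then have "k \<otimes> f \<in> K <#> F" "k \<in> carrier G"
          using \<open>f \<in> F\<close> K(2) unfolding set_mult_def by blast+
        then show "shift G f y k = shift G f x k"
          using fun_cong[OF \<open>restrict y _ = _\<close>, of "k \<otimes> f"] by (simp add: shift_def)
      qed
    qed (use \<open>x \<in> X\<close> \<open>y \<in> X\<close> shift_in \<open>f \<in> F\<close> F in auto)
    then show ?thesis
      using that unfolding A_def by blast
  qed
  \<comment> \<open>One representative point per pattern indexes the subcover by the finite set
    \<open>Q\<close>.\<close>
  define r where "r p = (SOME x. x \<in> X \<and> restrict x (K <#> F) = p)" for p
  have r: "r p \<in> X" "restrict (r p) (K <#> F) = p" if "p \<in> Q" for p
    using that someI_ex[of "\<lambda>x. x \<in> X \<and> restrict x (K <#> F) = p"] unfolding Q_def r_def by blast+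
  have "finite (K <#> F)" "K <#> F \<subseteq> carrier G"
    using K F unfolding set_mult_def by auto
  then have "finite Q"
    unfolding Q_def by (intro finite_patterns[OF _ finite_alphabet]) (use value_in_alphabet in auto)
  show thesis
  proof
    show "(\<lambda>p. A (r p)) ` Q \<subseteq> cover_power T (shift G) \<U> F"
      using A_mem r(1) by blast
    have "X \<subseteq> (\<Union>p\<in>Q. A (r p))"
    proof
      fix y assume "y \<in> X"
      then have q: "restrict y (K <#> F) \<in> Q"
        by (simp add: Q_def)
      have "y \<in> A (r (restrict y (K <#> F)))"
        by (rule in_A[OF r(1)[OF q] \<open>y \<in> X\<close> r(2)[OF q, symmetric]])
      with q show "y \<in> (\<Union>p\<in>Q. A (r p))"
        by blast
    qed
    moreover have "A x \<subseteq> X" for x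
      unfolding A_def by blast
    ultimately show "is_cover T ((\<lambda>p. A (r p)) ` Q)"
      unfolding is_cover_def topspace_T by blast
    show "card ((\<lambda>p. A (r p)) ` Q) \<le> pattern_count X (K <#> F)"
      using card_image_le[OF \<open>finite Q\<close>] unfolding pattern_count_def Q_def .
  qed (use \<open>finite Q\<close> in simp)
qed

lemma H_top_cover_power_le:
  assumes K: "finite K" "K \<subseteq> carrier G" and F: "finite F" "F \<subseteq> carrier G"
    and refine: "\<And>x. x \<in> X \<Longrightarrow> \<exists>U\<in>\<U>. \<forall>y\<in>X. (\<forall>k\<in>K. y k = x k) \<longrightarrow> y \<in> U"
  shows "H_top T (cover_power T (shift G) \<U> F) \<le> ln (pattern_count X (K <#> F))"
proof -
  obtain \<V> where \<V>: "\<V> \<subseteq> cover_power T (shift G) \<U> F" "finite \<V>" "is_cover T \<V>"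
    and card: "card \<V> \<le> pattern_count X (K <#> F)"
    by (rule small_subcover[OF assms])
  have "cover_number T (cover_power T (shift G) \<U> F) \<le> card \<V>"
    unfolding cover_number_def by (rule Least_le) (use \<V> in blast)
  also note card
  finally have le: "cover_number T (cover_power T (shift G) \<U> F) \<le> pattern_count X (K <#> F)" .
  have "finite (K <#> F)" "K <#> F \<subseteq> carrier G"
    using K F unfolding set_mult_def by auto
  then have "0 < pattern_count X (K <#> F)"
    by (rule patterns_pos)
  \<comment> \<open>Since \<open>ln 0 = 0\<close>, a cover number 0 also satisfies the bound;
    otherwise \<open>ln\<close> is monotone.\<close>
  with le show ?thesis
    unfolding H_top_def
    by (cases "cover_number T (cover_power T (shift G) \<U> F) = 0") (auto simp: Suc_le_eq)
qed

lemma time_zero_refine: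
  assumes "x \<in> X"
  shows "\<exists>U\<in>P. \<forall>y\<in>X. (\<forall>k\<in>{\<one>}. y k = x k) \<longrightarrow> y \<in> U"
proof
  show "{y\<in>X. y \<one> = x \<one>} \<in> P"
    using value_in_alphabet[OF assms one_closed] unfolding time_zero_cover_def by blast
qed simp

text \<open>\<open>shift G k x\<close> has the entry \<open>x k\<close> at the identity, so a member
  of the join fixes the letter at every \<open>k \<in> K\<close>. Different patterns on
  \<open>K\<close> therefore never share a member, which yields the lower bound for the cover
  number.\<close>

lemma time_zero_power_eq:
  assumes "A \<in> cover_power T (shift G) P K" "K \<subseteq> carrier G" "x \<in> A" "y \<in> A" "k \<in> K"
  shows "x k = y k"
proof -
  obtain s where s: "\<forall>f\<in>K. s f \<in> cover_preimage T (shift G f) P" "A = X \<inter> (\<Inter>f\<in>K. s f)"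
    using assms(1) unfolding cover_power_def topspace_T by blast
  then have "x \<in> s k" "y \<in> s k" "s k \<in> cover_preimage T (shift G k) P"
    using assms by blast+
  then obtain a where "shift G k x \<one> = a" "shift G k y \<one> = a"
    unfolding cover_preimage_def time_zero_cover_def by blast
  then show ?thesis
    using assms(2,5) by (auto simp: shift_def)
qed

text \<open>The upper bound is the general one with \<open>{\<one>}\<close> as the set of deciding
  coordinates; for the lower bound, each pattern needs its own member of a subcover.\<close>

lemma H_top_time_zero:
  assumes K: "finite K" "K \<subseteq> carrier G"
  shows "H_top T (cover_power T (shift G) P K) = ln (pattern_count X K)"
proof (rule antisym)
  have "{\<one>} <#> K = K"
    using K(2) by (simp add: lcos_mult_one flip: l_coset_eq_set_mult)
  then show "H_top T (cover_power T (shift G) P K) \<le> ln (pattern_count X K)"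
    using H_top_cover_power_le[OF _ _ K time_zero_refine] by simp
  have lower: "pattern_count X K \<le> card \<V>"
    if \<V>: "\<V> \<subseteq> cover_power T (shift G) P K" "finite \<V>" "is_cover T \<V>" for \<V>
    unfolding pattern_count_def
  \<comment> \<open>Reading off the pattern of an arbitrary point of each member maps
    \<open>\<V>\<close> onto the patterns on \<open>K\<close>.\<close>
  proof (rule surj_card_le[OF \<open>finite \<V>\<close>], rule subsetI)
    fix p assume "p \<in> (\<lambda>x. restrict x K) ` X"
    then obtain x where x: "x \<in> X" "p = restrict x K"
      by blast
    then obtain A where A: "A \<in> \<V>" "x \<in> A"
      using \<V>(3) unfolding is_cover_def topspace_T by blast
    then have "(SOME y. y \<in> A) \<in> A"
      by (metis someI)
    then have "restrict (SOME y. y \<in> A) K = p"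
      unfolding x using time_zero_power_eq[of A K] A \<V>(1) K(2) by (intro restrict_ext) blast
    with A show "p \<in> (\<lambda>A. restrict (SOME y. y \<in> A) K) ` \<V>"
      by blast
  qed
  \<comment> \<open>Once a finite subcover exists, the \<open>LEAST\<close> in
    \<open>cover_number\<close> is attained, and the lower bound applies to a minimal subcover
    \<open>\<W>\<close>.\<close>
  obtain \<V> where "\<V> \<subseteq> cover_power T (shift G) P K" "finite \<V>" "is_cover T \<V>"
    by (rule small_subcover[OF _ _ K time_zero_refine]) simp_all
  then have "\<exists>n. \<exists>\<V>\<subseteq>cover_power T (shift G) P K. finite \<V> \<and> is_cover T \<V> \<and> card \<V> = n"
    by blast
  from LeastI_ex[OF this, folded cover_number_def] obtain \<W>
    where \<W>: "\<W> \<subseteq> cover_power T (shift G) P K" "finite \<W>" "is_cover T \<W>"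
      "card \<W> = cover_number T (cover_power T (shift G) P K)"
    by (elim exE conjE)
  have "pattern_count X K \<le> cover_number T (cover_power T (shift G) P K)"
    using lower[OF \<W>(1-3)] \<W>(4) by simp
  then show "ln (pattern_count X K) \<le> H_top T (cover_power T (shift G) P K)"
    unfolding H_top_def using patterns_pos[OF K] by simp
qed

section \<open>Open covers and compactness\<close>

lemma open_cover_time_zero: "open_cover T P"
  unfolding open_cover_def is_cover_def
proof (intro conjI ballI)
  show "\<Union>P = topspace T"
    using value_in_alphabet[OF _ one_closed] unfolding time_zero_cover_def topspace_T by blast
  fix U assume "U \<in> P"
  then show "U \<subseteq> topspace T"
    unfolding time_zero_cover_def by auto
  obtain a where a: "a \<in> \<Lambda>" "U = {x\<in>X. x \<one> = a}"
    using \<open>U \<in> P\<close> unfolding time_zero_cover_def by blast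
  have "continuous_map T (discrete_topology \<Lambda>) (\<lambda>x. x \<one>)"
    unfolding subshift_topology_def full_shift_def
    by (intro continuous_map_from_subtopology continuous_map_product_projection) simp
  then have "openin T {x\<in>topspace T. x \<one> \<in> {a}}"
    by (rule openin_continuous_map_preimage) (use a in simp)
  with a show "openin T U"
    by simp
qed

text \<open>A Lebesgue number argument: compactness leaves finitely many basic boxes whose traces on
  \<open>X\<close> lie in members of \<open>\<U>\<close>, and together they constrain only finitely
  many coordinates.\<close>

lemma open_cover_refine:
  assumes "open_cover T \<U>"
  obtains K where "finite K" "K \<subseteq> carrier G"
    "\<And>x. x \<in> X \<Longrightarrow> \<exists>U\<in>\<U>. \<forall>y\<in>X. (\<forall>k\<in>K. y k = x k) \<longrightarrow> y \<in> U"
proof -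
  \<comment> \<open>Members of \<open>\<U>\<close> are open only relative to \<open>X\<close>, so
    just the trace of a box on \<open>X\<close> is required to lie in one of them.\<close>
  define box where "box V \<longleftrightarrow> finite {i\<in>carrier G. V i \<noteq> \<Lambda>} \<and> (\<forall>i\<in>carrier G. V i \<subseteq> \<Lambda>)
      \<and> (\<exists>U\<in>\<U>. X \<inter> Pi\<^sub>E (carrier G) V \<subseteq> U)" for V :: "'g \<Rightarrow> 'a set"
  have "compact_space (full_shift G \<Lambda>)"
    unfolding full_shift_def
    by (simp add: compact_space_product_topology compact_space_discrete_topology finite_alphabet)
  then have "compactin (full_shift G \<Lambda>) X"
    using subshift unfolding subshift_def by (blast intro: closedin_compact_space)
  moreover have "openin (full_shift G \<Lambda>) B" if "B \<in> Pi\<^sub>E (carrier G) ` {V. box V}" for B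
    using that unfolding full_shift_def box_def by (auto simp: openin_PiE_gen)
  moreover have "X \<subseteq> \<Union>(Pi\<^sub>E (carrier G) ` {V. box V})"
  proof
    fix x assume "x \<in> X"
    then obtain U where U: "U \<in> \<U>" "x \<in> U" "openin T U"
      using assms unfolding open_cover_def is_cover_def topspace_T by blast
    then obtain O' where O': "openin (full_shift G \<Lambda>) O'" "U = O' \<inter> X"
      unfolding subshift_topology_def openin_subtopology by blast
    with U have "x \<in> O'"
      by blast
    then have "\<exists>V. finite {i\<in>carrier G. V i \<noteq> topspace (discrete_topology \<Lambda>)}
        \<and> (\<forall>i\<in>carrier G. openin (discrete_topology \<Lambda>) (V i))
        \<and> x \<in> Pi\<^sub>E (carrier G) V \<and> Pi\<^sub>E (carrier G) V \<subseteq> O'"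
      using O'(1) unfolding full_shift_def openin_product_topology_alt by (rule bspec[rotated])
    then obtain V where V: "finite {i\<in>carrier G. V i \<noteq> \<Lambda>}" "\<forall>i\<in>carrier G. V i \<subseteq> \<Lambda>"
      "x \<in> Pi\<^sub>E (carrier G) V" "Pi\<^sub>E (carrier G) V \<subseteq> O'"
      unfolding topspace_discrete_topology openin_discrete_topology by (elim exE conjE)
    then have "box V"
      unfolding box_def using U(1) O'(2) by (intro conjI bexI[of _ U]) auto
    with V show "x \<in> \<Union>(Pi\<^sub>E (carrier G) ` {V. box V})"
      by blast
  qed
  ultimately obtain \<F> where \<F>: "finite \<F>" "\<F> \<subseteq> Pi\<^sub>E (carrier G) ` {V. box V}" "X \<subseteq> \<Union>\<F>"
    using compactinD by metis
  \<comment> \<open>The finite subfamily is pulled back to the families of sides \<open>V\<close>,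
    from which the constrained coordinates are read off.\<close>
  then obtain \<W> where \<W>: "finite \<W>" "\<W> \<subseteq> {V. box V}" "\<F> = Pi\<^sub>E (carrier G) ` \<W>"
    using finite_subset_image by metis
  define K where "K = (\<Union>V\<in>\<W>. {i\<in>carrier G. V i \<noteq> \<Lambda>})"
  show thesis
  proof
    show "finite K" "K \<subseteq> carrier G"
      using \<W> unfolding K_def box_def by auto
    fix x assume "x \<in> X"
    then obtain V where V: "V \<in> \<W>" "x \<in> Pi\<^sub>E (carrier G) V"
      using \<F> \<W> by blast
    then obtain U where U: "U \<in> \<U>" "X \<inter> Pi\<^sub>E (carrier G) V \<subseteq> U"
      using \<W> unfolding box_def by blast
    have "y \<in> U" if "y \<in> X" "\<forall>k\<in>K. y k = x k" for y
    proof -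
      \<comment> \<open>Outside \<open>K\<close> the side \<open>V i\<close> is all of
        \<open>\<Lambda>\<close> and constrains nothing; inside \<open>K\<close>, \<open>y\<close>
        inherits the entry of \<open>x\<close>.\<close>
      have "y i \<in> V i" if "i \<in> carrier G" for i
      proof (cases "V i = \<Lambda>")
        case True
        then show ?thesis
          using value_in_alphabet \<open>y \<in> X\<close> that by blast
      next
        case False
        then have "i \<in> K"
          using V that unfolding K_def by blast
        then show ?thesis
          using \<open>\<forall>k\<in>K. y k = x k\<close> V that by auto
      qed
      moreover have "y \<in> extensional (carrier G)"
        using X_subset \<open>y \<in> X\<close> by (auto simp: PiE_def)
      ultimately show ?thesis
        using U \<open>y \<in> X\<close> by (auto simp: PiE_def)
    qed
    with U show "\<exists>U\<in>\<U>. \<forall>y\<in>X. (\<forall>k\<in>K. y k = x k) \<longrightarrow> y \<in> U"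
      by blast
  qed
qed

section \<open>Entropy bounds along the Folner sequence\<close>

text \<open>The set \<open>K\<close> deciding \<open>\<U>\<close> enters only through the part of
  \<open>K <#> F n\<close> outside \<open>F n\<close>, whose relative size vanishes. The bound is
  thus uniform in \<open>\<U>\<close> and serves the supremum over covers and the infimum over
  \<open>L\<close> at once.\<close>

lemma h_top_cover_le:
  assumes F: "folner_sequence G F" and \<U>: "open_cover T \<U>"
    and L: "L \<in> finite_nonempty_subsets G"
  shows "h_top_cover T (shift G) F \<U> \<le> ereal (ln (pattern_count X L) / card L)"
proof -
  obtain K where K: "finite K" "K \<subseteq> carrier G"
    and refine: "\<And>x. x \<in> X \<Longrightarrow> \<exists>U\<in>\<U>. \<forall>y\<in>X. (\<forall>k\<in>K. y k = x k) \<longrightarrow> y \<in> U"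
    using open_cover_refine[OF \<U>] by metis
  have L: "finite L" "L \<subseteq> carrier G" "L \<noteq> {}"
    using L unfolding finite_nonempty_subsets_def by auto
  have Fn: "finite (F n)" "F n \<subseteq> carrier G" "0 < card (F n)" for n
    using F unfolding folner_sequence_def finite_nonempty_subsets_def by (auto simp: card_gt_0_iff)
  \<comment> \<open>\<open>d\<close> counts the coordinates added to \<open>F n\<close> in order to
    decide \<open>\<U>\<close>; \<open>d'\<close> bounds the excess of the number of translates of
    \<open>L\<close> in Shearer's inequality over \<open>card (F n)\<close>.\<close>
  define d where "d n = card ((K <#> F n) - F n)" for n
  define d' where "d' n = card (((m_inv G ` L) <#> F n) - F n)" for n
  define c where "c = ln (pattern_count X L) / card L"
  define a where "a = ln (card \<Lambda>)"
  let ?b = "\<lambda>n. (1 + real (d' n) / card (F n)) * c + real (d n) / card (F n) * a"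
  have "0 \<le> c"
    using patterns_pos[OF L(1,2)] unfolding c_def by (simp add: Suc_le_eq)
  have "H_top T (cover_power T (shift G) \<U> (F n)) / card (F n) \<le> ?b n" for n
  proof -
    have fin: "finite (S <#> F n)" if "finite S" for S
      using that Fn(1) unfolding set_mult_def by auto
    have KF: "K <#> F n \<subseteq> carrier G"
      using K Fn(2) by (simp add: set_mult_closed)
    have in_\<Lambda>: "x h \<in> \<Lambda>" if "x \<in> X" "h \<in> F n \<union> (K <#> F n)" for x h
      using that value_in_alphabet KF Fn(2) by blast
    have "K <#> F n \<subseteq> F n \<union> ((K <#> F n) - F n)"
      by blast
    then have "pattern_count X (K <#> F n) \<le> pattern_count X (F n \<union> ((K <#> F n) - F n))"
      by (intro pattern_count_mono[OF _ finite_alphabet])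
         (use fin[OF K(1)] Fn(1) in_\<Lambda> in auto)
    also have "\<dots> \<le> pattern_count X (F n) * card \<Lambda> ^ d n"
      unfolding d_def
      by (intro pattern_count_Un_le[OF _ _ finite_alphabet])
         (use fin[OF K(1)] Fn(1) in_\<Lambda> in auto)
    finally have le: "pattern_count X (K <#> F n) \<le> pattern_count X (F n) * card \<Lambda> ^ d n" .
    have pos: "0 < pattern_count X (K <#> F n)"
      using patterns_pos[OF fin[OF K(1)] KF] .
    have "H_top T (cover_power T (shift G) \<U> (F n)) \<le> ln (pattern_count X (K <#> F n))"
      by (rule H_top_cover_power_le[OF K Fn(1,2) refine])
    also have "\<dots> \<le> ln (real (pattern_count X (F n)) * real (card \<Lambda>) ^ d n)"
      using le pos by (metis of_nat_0_less_iff of_nat_mono of_nat_mult of_nat_power ln_mono)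
    also have "\<dots> = ln (pattern_count X (F n)) + d n * a"
    proof -
      \<comment> \<open>A positive count is bounded by a product with this factor, so the factor is
        nonzero and the logarithm can be split.\<close>
      have "0 < card \<Lambda> ^ d n"
        using le pos by (metis gr0I mult_is_0 not_le)
      then have "0 < real (card \<Lambda>) ^ d n"
        by (metis of_nat_0_less_iff of_nat_power)
      then show ?thesis
        using patterns_pos[OF Fn(1,2)[of n]] by (simp add: ln_mult ln_realpow a_def)
    qed
    also have "ln (pattern_count X (F n)) \<le> real (card ((m_inv G ` L) <#> F n)) * c"
      unfolding c_def by (rule ln_pattern_count_le[OF L Fn(1,2)])
    also have "\<dots> \<le> (real (card (F n)) + d' n) * c"
    proof (rule mult_right_mono[OF _ \<open>0 \<le> c\<close>])
      have "card ((m_inv G ` L) <#> F n) \<le> card (F n \<union> (((m_inv G ` L) <#> F n) - F n))"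
        by (rule card_mono) (use fin L Fn in auto)
      also have "\<dots> \<le> card (F n) + d' n"
        unfolding d'_def by (rule card_Un_le)
      finally show "real (card ((m_inv G ` L) <#> F n)) \<le> real (card (F n)) + d' n"
        by simp
    qed
    finally have "H_top T (cover_power T (shift G) \<U> (F n)) \<le> (real (card (F n)) + d' n) * c + d n * a"
      by simp
    then show ?thesis
      using Fn(3)[of n] by (simp add: field_simps)
  qed
  then have "h_top_cover T (shift G) F \<U> \<le> limsup (\<lambda>n. ereal (?b n))"
    unfolding h_top_cover_def by (intro Limsup_mono always_eventually allI) simp
  \<comment> \<open>Both boundary quotients tend to 0, so only \<open>c\<close> survives in the
    limit.\<close>
  also have "\<dots> = ereal ((1 + 0) * c + 0 * a)"
  proof (intro lim_imp_Limsup tendsto_ereal tendsto_intros)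
    show "(\<lambda>n. real (d n) / card (F n)) \<longlonglongrightarrow> 0"
      unfolding d_def by (rule folner_boundary[OF F K])
    show "(\<lambda>n. real (d' n) / card (F n)) \<longlonglongrightarrow> 0"
      unfolding d'_def by (rule folner_boundary[OF F]) (use L in auto)
  qed simp
  finally show ?thesis
    by (simp add: c_def)
qed

end

theorem corollary6p3:
  fixes G :: "('g, 'b) monoid_scheme"
    and F :: "nat \<Rightarrow> 'g set"
    and \<Lambda> :: "'a set"
    and X :: "('g \<Rightarrow> 'a) set"
  assumes "countable_amenable_group G"
    and "folner_sequence G F"
    and "finite \<Lambda>"
    and "subshift G \<Lambda> X"
    and "X \<noteq> {}"
  shows "h_top (subshift_topology G \<Lambda> X) (shift G) F
           = h_top_cover (subshift_topology G \<Lambda> X) (shift G) F (time_zero_cover G \<Lambda> X)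
       \<and> h_top_cover (subshift_topology G \<Lambda> X) (shift G) F (time_zero_cover G \<Lambda> X)
           = (INF K \<in> finite_nonempty_subsets G.
                ereal (H_top (subshift_topology G \<Lambda> X)
                         (cover_power (subshift_topology G \<Lambda> X) (shift G)
                            (time_zero_cover G \<Lambda> X) K) / real (card K)))"
proof -
  interpret group G
    using assms(1) unfolding countable_amenable_group_def by blast
  interpret finite_alphabet_subshift G \<Lambda> X
    by unfold_locales (fact assms)+
  let ?r = "\<lambda>K. ereal (H_top T (cover_power T (shift G) P K) / real (card K))"
  let ?inf = "INF K \<in> finite_nonempty_subsets G. ?r K"
  let ?hP = "h_top_cover T (shift G) F P"
  \<comment> \<open>Each \<open>F n\<close> is itself among the sets of the infimum, which therefore
    lies below every term of the limsup.\<close>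
  have "?inf \<le> ?r (F n)" for n
    by (rule INF_lower) (use assms(2) in \<open>simp add: folner_sequence_def\<close>)
  then have inf_le: "?inf \<le> ?hP"
    unfolding h_top_cover_def by (intro le_Limsup always_eventually allI) simp_all
  have hP_le: "?hP \<le> h_top T (shift G) F"
    unfolding h_top_def by (rule SUP_upper) (simp add: open_cover_time_zero)
  \<comment> \<open>This closes the circle from \<open>?inf\<close> through \<open>?hP\<close> and
    \<open>h_top\<close> back to \<open>?inf\<close>; \<open>H_top_time_zero\<close> turns the
    pattern count in the bound into the entropy of the time-zero join.\<close>
  have h_le: "h_top T (shift G) F \<le> ?inf"
    unfolding h_top_def
  proof (intro SUP_least INF_greatest)
    fix \<U> K assume "\<U> \<in> {\<U>. open_cover T \<U>}" and K: "K \<in> finite_nonempty_subsets G"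
    then show "h_top_cover T (shift G) F \<U> \<le> ?r K"
      using h_top_cover_le[OF assms(2), of \<U> K] H_top_time_zero[of K]
      unfolding finite_nonempty_subsets_def by simp
  qed
  have "h_top T (shift G) F = ?hP"
    using order_trans[OF h_le inf_le] hP_le by (rule order_antisym)
  moreover have "?hP = ?inf"
    using order_trans[OF hP_le h_le] inf_le by (rule order_antisym)
  ultimately show ?thesis ..
qed

end
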